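(* Let $G=(V,E)$ be a graph and let $S_1,S_2\subseteq V$ be nonempty with $S_1\cup S_2=V$, such that there is no vertex $u\in S_2$ with $N[u]\cap S_1=S_1$. Let $b^*=\mathrm{box}(G)$, let $t$ be an integer with $1\le t\le|S_1|$, let $\beta_t=\beta_t(S_1,S_2)$, let $t^*=|S_2|\bigl(1-2b^*(1-\beta_t)\bigr)$ and let $\alpha^*=\alpha_{t^*}(S_2,S_1)$. Then $$\mathrm{box}(G)\ge\frac{1}{2\left(1-\beta_t+\frac{t-1}{\alpha^*|S_2|}\right)},$$ where $\frac{t-1}{\alpha^*|S_2|}$ is interpreted as $0$ when $\alpha^*=\infty$.
   Context: Graphs are finite, simple, undirected. The boxicity $\mathrm{box}(G)$ is the minimum $k$ such that there are interval graphs $I_1,\dots,I_k$ on $V$ with $E(G)=E(I_1)\cap\cdots\cap E(I_k)$. For $X\subseteq V$ and a graph $H$ on $V$, $N'(X,H)=\{u : \exists v\in X,\ uv\in E(H)\}$ and $N[X,H]=X\cup N'(X,H)$; $N[u]=N[\{u\},G]$. $\overline{G}$ is the complement of $G$. Cross expansion: for $A,B\subseteq V$ and an integer $1\le t\le|A|$, let $n_t=\min_{S\subseteq A,|S|=t}|N[S,G]\cap B|$ and $\beta_t(A,B)=n_t/|B|$. Co-expansion: for $A,B\subseteq V$ and a positive integer $t\le|A|$, let $m_t=\min_{S\subseteq A,|S|=t}|N'(S,\overline{G})\cap B|$ and $\alpha_t(A,B)=m_t/t$; for $t\le 0$ set $\alpha_t(A,B)=\infty$. (Note $t^*$ is an integer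 not exceeding $|S_2|$.) *)

theory Defs
  imports Complex_Main "HOL-Library.Extended_Real" "Graph_Theory.Pair_Digraph"
begin

text \<open>
  Finite simple undirected graphs are rendered by the locale predicate \<^const>\<open>pair_graph\<close>
  (finite, symmetric, loop-free): an edge \<open>uv\<close> is the pair of arcs
  \<open>(u, v)\<close>, \<open>(v, u)\<close>.
\<close>

definition interval_graph :: "'a pair_pre_digraph \<Rightarrow> bool" where
  "interval_graph H \<longleftrightarrow> pair_graph H \<and>
    (\<exists>l r :: 'a \<Rightarrow> real. (\<forall>v\<in>pverts H. l v \<le> r v) \<and>
      (\<forall>u\<in>pverts H. \<forall>v\<in>pverts H. u \<noteq> v \<longrightarrow>
        ((u, v) \<in> parcs H \<longleftrightarrow> {l u..r u} \<inter> {l v..r v} \<noteq> {})))"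

definition complete_arcs :: "'a set \<Rightarrow> 'a rel" where
  "complete_arcs V = {(u, v). u \<in> V \<and> v \<in> V \<and> u \<noteq> v}"

definition interval_representation :: "'a pair_pre_digraph \<Rightarrow> nat \<Rightarrow> (nat \<Rightarrow> 'a pair_pre_digraph) \<Rightarrow> bool" where
  "interval_representation G k I \<longleftrightarrow>
    (\<forall>i<k. interval_graph (I i) \<and> pverts (I i) = pverts G) \<and>
    parcs G = complete_arcs (pverts G) \<inter> (\<Inter>i<k. parcs (I i))"

text \<open>
  The factor \<^term>\<open>complete_arcs (pverts G)\<close> in the definition above only matters for
  \<open>k = 0\<close>: the empty intersection consists of all pairs of distinct vertices, so complete
  graphs have boxicity \<open>0\<close>.
\<close>

definition boxicity :: "'a pair_pre_digraph \<Rightarrow> nat" where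
  "boxicity G = (LEAST k. \<exists>I. interval_representation G k I)"

definition open_nbhd :: "'a set \<Rightarrow> 'a pair_pre_digraph \<Rightarrow> 'a set" where
  "open_nbhd X H = {u. \<exists>v\<in>X. (u, v) \<in> parcs H}"

definition closed_nbhd :: "'a set \<Rightarrow> 'a pair_pre_digraph \<Rightarrow> 'a set" where
  "closed_nbhd X H = X \<union> open_nbhd X H"

definition graph_complement :: "'a pair_pre_digraph \<Rightarrow> 'a pair_pre_digraph" where
  "graph_complement G = \<lparr>pverts = pverts G, parcs = complete_arcs (pverts G) - parcs G\<rparr>"

text \<open>
  The minima below are over finite nonempty sets of numbers when \<open>A\<close> and \<open>B\<close>
  are finite and \<open>1 \<le> t \<le> |A|\<close>.
\<close>

definition cross_expansion :: "'a pair_pre_digraph \<Rightarrow> nat \<Rightarrow> 'a set \<Rightarrow> 'a set \<Rightarrow> real" where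
  "cross_expansion G t A B =
    real (Min {card (closed_nbhd S G \<inter> B) | S. S \<subseteq> A \<and> card S = t}) / real (card B)"

definition co_expansion :: "'a pair_pre_digraph \<Rightarrow> int \<Rightarrow> 'a set \<Rightarrow> 'a set \<Rightarrow> ereal" where
  "co_expansion G t A B =
    (if t \<le> 0 then \<infinity>
     else ereal (real (Min {card (open_nbhd S (graph_complement G) \<inter> B) | S. S \<subseteq> A \<and> card S = nat t})
            / real_of_int t))"

text \<open>Every graph has an interval representation, so the minimum defining the boxicity exists.\<close>

lemma interval_graph_all_but_one_edge:
  assumes "finite V" "a \<in> V" "b \<in> V" "a \<noteq> b"
  shows "interval_graph \<lparr>pverts = V, parcs = complete_arcs V - {(a, b), (b, a)}\<rparr>"
proof -
  let ?H = "\<lparr>pverts = V, parcs = complete_arcs V - {(a, b), (b, a)}\<rparr>"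
  have "complete_arcs V \<subseteq> V \<times> V"
    by (auto simp: complete_arcs_def)
  then have "finite (complete_arcs V)"
    using assms(1) finite_subset by blast
  then have g: "pair_graph ?H"
    using assms by unfold_locales (auto simp: complete_arcs_def symmetric_def sym_def)
  let ?l = "\<lambda>v. if v = b then 1 else 0 :: real" and ?r = "\<lambda>v. if v = a then 0 else 1 :: real"
  have "\<forall>v\<in>pverts ?H. ?l v \<le> ?r v"
    using assms by auto
  moreover have "\<forall>u\<in>pverts ?H. \<forall>v\<in>pverts ?H. u \<noteq> v \<longrightarrow>
      ((u, v) \<in> parcs ?H \<longleftrightarrow> {?l u..?r u} \<inter> {?l v..?r v} \<noteq> {})"
    using assms by (auto simp: complete_arcs_def Int_atLeastAtMost)
  ultimately show ?thesis
    unfolding interval_graph_def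
    by (intro conjI g exI[of _ ?l] exI[of _ ?r])
qed

lemma interval_representation_exists:
  assumes "pair_graph G"
  shows "\<exists>k I. interval_representation G k I"
proof -
  interpret pair_graph G by fact
  let ?C = "complete_arcs (pverts G) - parcs G"
  have "?C \<subseteq> pverts G \<times> pverts G"
    by (auto simp: complete_arcs_def)
  then have "finite ?C"
    using pair_finite_verts finite_subset by blast
  then obtain f :: "nat \<Rightarrow> 'a \<times> 'a" and k where f: "?C = f ` {i. i < k}"
    using finite_imp_nat_seg_image_inj_on by metis
  define I where
    "I i = \<lparr>pverts = pverts G,
            parcs = complete_arcs (pverts G) - {f i, (snd (f i), fst (f i))}\<rparr>" for i
  have "interval_graph (I i)" if "i < k" for i
  proof -
    have "f i \<in> ?C"
      using that f by auto
    then show ?thesis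
      using interval_graph_all_but_one_edge[of "pverts G" "fst (f i)" "snd (f i)"] pair_finite_verts
      by (auto simp: I_def complete_arcs_def)
  qed
  moreover have "parcs G = complete_arcs (pverts G) \<inter> (\<Inter>i<k. parcs (I i))"
  proof (intro equalityI subrelI)
    fix u v assume uv: "(u, v) \<in> parcs G"
    have c: "(x, y) \<in> complete_arcs (pverts G)" if "(x, y) \<in> parcs G" for x y
      using that in_arcsD1 in_arcsD2 no_loops' by (auto simp: complete_arcs_def)
    have vu: "(v, u) \<in> parcs G"
      using uv pair_sym_arcs by (auto simp: symmetric_def sym_def)
    have "(u, v) \<in> parcs (I i)" if "i < k" for i
    proof -
      have "f i \<notin> parcs G"
        using that f by blast
      then show ?thesis
        using uv vu c[OF uv] by (auto simp: I_def)
    qed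
    then show "(u, v) \<in> complete_arcs (pverts G) \<inter> (\<Inter>i<k. parcs (I i))"
      using c[OF uv] by auto
  next
    fix u v assume uv: "(u, v) \<in> complete_arcs (pverts G) \<inter> (\<Inter>i<k. parcs (I i))"
    show "(u, v) \<in> parcs G"
    proof (rule ccontr)
      assume "(u, v) \<notin> parcs G"
      then have "(u, v) \<in> f ` {i. i < k}"
        using uv f by blast
      then obtain i where "i < k" "f i = (u, v)"
        by auto
      moreover have "(u, v) \<in> parcs (I i)"
        using uv \<open>i < k\<close> by blast
      ultimately show False
        by (simp add: I_def)
    qed
  qed
  ultimately have "interval_representation G k I"
    by (auto simp: interval_representation_def I_def)
  then show ?thesis
    by blast
qed

text \<open>\<open>|B| (1 - 2 b (1 - \<beta>\<^sub>t(A, B)))\<close> is an integer for every natural number \<open>b\<close>.\<close>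

lemma cross_expansion_threshold_integer:
  assumes "finite B" "B \<noteq> {}"
  shows "\<exists>!k :: int. real_of_int k =
    real (card B) * (1 - 2 * real b * (1 - cross_expansion G t A B))"
proof -
  define n where "n = Min {card (closed_nbhd S G \<inter> B) | S. S \<subseteq> A \<and> card S = t}"
  have "real_of_int (int (card B) - 2 * int b * (int (card B) - int n)) =
      real (card B) * (1 - 2 * real b * (1 - cross_expansion G t A B))"
    using assms unfolding cross_expansion_def n_def[symmetric] by (simp add: field_simps)
  then show ?thesis
    by (metis of_int_eq_iff)
qed

end

theory Submission
  imports Defs
begin

text \<open>
  Fix an interval representation of \<open>G\<close> with \<open>b = box(G)\<close> interval graphs. In each of them let
  \<open>P\<close> be \<open>t\<close> vertices of \<open>S\<^sub>1\<close> with smallest right endpoints and \<open>Q\<close> be \<open>t\<close> vertices of \<open>S\<^sub>1\<close> with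
  largest left endpoints. By cross expansion all but \<open>2b(1 - \<beta>)|S\<^sub>2|\<close> vertices of \<open>S\<^sub>2\<close>, hence at
  least \<open>t\<^sup>*\<close> of them, lie in the closed neighbourhood of every \<open>P\<close> and every \<open>Q\<close>. The interval of
  such a vertex starts no later than the \<open>t\<close>-th smallest right endpoint and ends no earlier than
  the \<open>t\<close>-th largest left endpoint in \<open>S\<^sub>1\<close>, so it can miss only the at most \<open>t - 1\<close> intervals of
  \<open>S\<^sub>1\<close> with a strictly smaller right endpoint and the at most \<open>t - 1\<close> with a strictly larger left
  endpoint; these do not depend on the vertex. Hence the \<open>t\<^sup>*\<close> vertices together have at most
  \<open>2b(t - 1)\<close> non-neighbours in \<open>S\<^sub>1\<close>, that is \<open>\<alpha>\<^sup>* t\<^sup>* \<le> 2b(t - 1)\<close>. Since no vertex of \<open>S\<^sub>2\<close>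
  dominates \<open>S\<^sub>1\<close>, \<open>\<alpha>\<^sup>* > 0\<close> and the inequality rearranges to the claim. If \<open>t\<^sup>* \<le> 0\<close>, the
  claim is already \<open>2b(1 - \<beta>) \<ge> 1\<close>.
\<close>

section \<open>Order statistics of a real function on a finite set\<close>

lemma ex_smallest_subset:
  fixes f :: "'a \<Rightarrow> real"
  assumes "finite A" "t \<le> card A"
  shows "\<exists>P\<subseteq>A. card P = t \<and> (\<forall>x\<in>P. \<forall>y\<in>A - P. f x \<le> f y)"
  using assms(2)
proof (induction t)
  case 0
  show ?case by (intro exI[of _ "{}"]) auto
next
  case (Suc t)
  then obtain P where P: "P \<subseteq> A" "card P = t" "\<forall>x\<in>P. \<forall>y\<in>A - P. f x \<le> f y"
    by auto
  have finP: "finite P"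
    using P(1) assms(1) finite_subset by blast
  have ne: "A - P \<noteq> {}"
    using Suc.prems P(1,2) by auto
  obtain m where m: "m \<in> A - P" "\<forall>y\<in>A - P. f m \<le> f y"
    using ex_min_if_finite[of "f ` (A - P)"] assms(1) ne
    by (metis (no_types, lifting) finite_Diff finite_imageI image_iff image_is_empty not_less)
  show ?case
    using P m finP by (intro exI[of _ "insert m P"]) auto
qed

text \<open>Take \<open>c\<close> as the maximum of \<open>f\<close> over \<open>t\<close> smallest
  elements. Anything strictly below \<open>c\<close> lies in \<open>P\<close> and differs from the
  maximiser, hence \<open>t - 1\<close> and not \<open>t\<close>.\<close>

lemma ex_order_statistic:
  fixes f :: "'a \<Rightarrow> real"
  assumes "finite A" "1 \<le> t" "t \<le> card A"
  shows "\<exists>P\<subseteq>A. \<exists>c. card P = t \<and> (\<forall>x\<in>P. f x \<le> c) \<and> card {y \<in> A. f y < c} \<le> t - 1"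
proof -
  obtain P where P: "P \<subseteq> A" "card P = t" "\<forall>x\<in>P. \<forall>y\<in>A - P. f x \<le> f y"
    using ex_smallest_subset[OF assms(1,3)] by blast
  have finP: "finite P"
    using P(1) assms(1) finite_subset by blast
  have ne: "P \<noteq> {}"
    using P(2) assms(2) by auto
  have "Max (f ` P) \<in> f ` P"
    using finP ne by simp
  then obtain p where p: "p \<in> P" "f p = Max (f ` P)"
    by auto
  have le: "\<forall>x\<in>P. f x \<le> f p"
    using finP p(2) by simp
  have "{y \<in> A. f y < f p} \<subseteq> P - {p}"
    using P(3) p(1) by force
  then have "card {y \<in> A. f y < f p} \<le> card (P - {p})"
    using finP by (intro card_mono) auto
  also have "\<dots> = t - 1"
    using finP p(1) P(2) by simp
  finally show ?thesis
    using P(1,2) le by blast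
qed

lemma closed_nbhd_mono: "parcs G \<subseteq> parcs H \<Longrightarrow> closed_nbhd X G \<subseteq> closed_nbhd X H"
  by (auto simp: closed_nbhd_def open_nbhd_def)

section \<open>Non-neighbours within one interval graph\<close>

lemma interval_graph_few_nonneighbours:
  assumes I: "interval_graph H" and S: "S \<subseteq> pverts H" and t: "1 \<le> t" "t \<le> card S"
  shows "\<exists>P Q D. P \<subseteq> S \<and> card P = t \<and> Q \<subseteq> S \<and> card Q = t \<and> finite D \<and> card D \<le> 2 * (t - 1) \<and>
    (\<forall>u\<in>pverts H \<inter> closed_nbhd P H \<inter> closed_nbhd Q H. \<forall>v\<in>S - D. u \<noteq> v \<longrightarrow> (u, v) \<in> parcs H)"
proof -
  obtain l r :: "'a \<Rightarrow> real" where lr: "\<forall>v\<in>pverts H. l v \<le> r v"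
    and arc: "\<forall>u\<in>pverts H. \<forall>v\<in>pverts H. u \<noteq> v \<longrightarrow>
        ((u, v) \<in> parcs H \<longleftrightarrow> {l u..r u} \<inter> {l v..r v} \<noteq> {})"
    and H: "pair_graph H"
    using I unfolding interval_graph_def by blast
  interpret pair_graph H by fact
  have arc': "(u, v) \<in> parcs H \<longleftrightarrow> l u \<le> r v \<and> l v \<le> r u"
    if "u \<in> pverts H" "v \<in> pverts H" "u \<noteq> v" for u v
    using arc lr that by (auto simp: Int_atLeastAtMost)
  have meet: "l u \<le> r v \<and> l v \<le> r u" if "u \<in> pverts H" "(u, v) \<in> parcs H" for u v
    using that arc' in_arcsD2 no_loops' by metis
  have fin: "finite S"
    using S finite_subset pair_finite_verts by blast
  obtain P c where P: "P \<subseteq> S" "card P = t" "\<forall>x\<in>P. r x \<le> c" "card {y \<in> S. r y < c} \<le> t - 1"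
    using ex_order_statistic[OF fin t] by metis
  \<comment> \<open>With \<open>- l\<close> in place of \<open>r\<close>, \<open>- d\<close> is the
    \<open>t\<close>-th largest left endpoint.\<close>
  obtain Q d where Q: "Q \<subseteq> S" "card Q = t" "\<forall>x\<in>Q. - l x \<le> d" "card {y \<in> S. - l y < d} \<le> t - 1"
    using ex_order_statistic[OF fin t] by metis
  define D where "D = {y \<in> S. r y < c} \<union> {y \<in> S. - l y < d}"
  have "card D \<le> 2 * (t - 1)"
    unfolding D_def using card_Un_le[of "{y \<in> S. r y < c}" "{y \<in> S. - l y < d}"] P(4) Q(4) by linarith
  moreover have "finite D"
    using fin by (simp add: D_def)
  moreover have "(u, v) \<in> parcs H"
    if u: "u \<in> pverts H" "u \<in> closed_nbhd P H" "u \<in> closed_nbhd Q H"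
      and v: "v \<in> S - D" "u \<noteq> v" for u v
  proof -
    \<comment> \<open>Either \<open>u\<close> itself lies in \<open>P\<close>, and then
      \<open>p = u\<close> works, or \<open>u\<close> is adjacent to some \<open>p\<close> in
      \<open>P\<close>.\<close>
    obtain p where p: "p \<in> P" "l u \<le> r p"
      using u(1,2) lr meet unfolding closed_nbhd_def open_nbhd_def by blast
    obtain q where q: "q \<in> Q" "l q \<le> r u"
      using u(1,3) lr meet unfolding closed_nbhd_def open_nbhd_def by blast
    \<comment> \<open>The chains \<open>l u \<le> r p \<le> c \<le> r v\<close> and
      \<open>l v \<le> - d \<le> l q \<le> r u\<close> make the two intervals meet.\<close>
    have "c \<le> r v" "l v \<le> - d"
      using v(1) by (auto simp: D_def)
    moreover have "r p \<le> c" "- d \<le> l q"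
      using p(1) q(1) P(3) Q(3) by force+
    ultimately show ?thesis
      using arc'[of u v] u(1) v S p(2) q(2) by auto
  qed
  ultimately show ?thesis
    using P(1,2) Q(1,2) by blast
qed

section \<open>Minima over subsets of fixed size and a union bound\<close>

lemma Min_card_subsets_le:
  fixes f :: "'a set \<Rightarrow> nat"
  assumes "finite A" "S \<subseteq> A" "card S = t"
  shows "Min {f S | S. S \<subseteq> A \<and> card S = t} \<le> f S"
  using assms by (intro Min_le) auto

lemma Min_card_subsets_attained:
  fixes f :: "'a set \<Rightarrow> nat"
  assumes "finite A" "t \<le> card A"
  obtains S where "S \<subseteq> A" "card S = t" "Min {f S | S. S \<subseteq> A \<and> card S = t} = f S"
proof -
  have "{f S | S. S \<subseteq> A \<and> card S = t} \<noteq> {}"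
    using obtain_subset_with_card_n[OF assms(2)] by blast
  then have "Min {f S | S. S \<subseteq> A \<and> card S = t} \<in> {f S | S. S \<subseteq> A \<and> card S = t}"
    using assms(1) by (intro Min_in) auto
  then show ?thesis
    using that by auto
qed

lemma card_UN_lessThan_le:
  assumes "\<And>i. i < b \<Longrightarrow> card (B i) \<le> k"
  shows "card (\<Union>i<b. B i) \<le> b * k"
proof -
  have "card (\<Union>i<b. B i) \<le> (\<Sum>i<b. card (B i))"
    by (rule card_UN_le) simp
  also have "\<dots> \<le> b * k"
    using sum_bounded_above[of "{..<b}" "\<lambda>i. card (B i)" k] assms by simp
  finally show ?thesis .
qed

text \<open>Each interval graph costs at most \<open>2 * (card S2 - n)\<close> vertices of
  \<open>S2\<close>, those outside one of its two closed neighbourhoods. The bound on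
  \<open>card T\<close> is additive because a difference in \<open>nat\<close> could
  truncate.\<close>

lemma representation_few_nonneighbours:
  assumes G: "pair_graph G" and rep: "interval_representation G b I"
    and S: "S1 \<subseteq> pverts G" "S2 \<subseteq> pverts G" and t: "1 \<le> t" "t \<le> card S1"
    and n: "\<And>P. P \<subseteq> S1 \<Longrightarrow> card P = t \<Longrightarrow> n \<le> card (closed_nbhd P G \<inter> S2)"
  shows "\<exists>T\<subseteq>S2. card S2 \<le> card T + b * (2 * (card S2 - n)) \<and>
    card (open_nbhd T (graph_complement G) \<inter> S1) \<le> b * (2 * (t - 1))"
proof -
  interpret pair_graph G by fact
  have fin: "finite S1" "finite S2"
    using S finite_subset pair_finite_verts by blast+
  have I: "interval_graph (I i)" "pverts (I i) = pverts G" if "i < b" for i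
    using rep that by (auto simp: interval_representation_def)
  have arcs: "parcs G = complete_arcs (pverts G) \<inter> (\<Inter>i<b. parcs (I i))"
    using rep by (auto simp: interval_representation_def)
  define good where "good i P Q D \<longleftrightarrow> P \<subseteq> S1 \<and> card P = t \<and> Q \<subseteq> S1 \<and> card Q = t \<and> finite D \<and> card D \<le> 2 * (t - 1) \<and>
      (\<forall>u\<in>pverts G \<inter> closed_nbhd P (I i) \<inter> closed_nbhd Q (I i).
        \<forall>v\<in>S1 - D. u \<noteq> v \<longrightarrow> (u, v) \<in> parcs (I i))" for i P Q D
  have "\<exists>P Q D. good i P Q D" if "i < b" for i
    using interval_graph_few_nonneighbours[OF I(1)[OF that] _ t] S(1)
    unfolding I(2)[OF that] good_def by blast
  then obtain P Q D where "\<And>i. i < b \<Longrightarrow> good i (P i) (Q i) (D i)"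
    by metis
  then have PQD: "\<And>i. i < b \<Longrightarrow> P i \<subseteq> S1 \<and> card (P i) = t \<and> Q i \<subseteq> S1 \<and>
      card (Q i) = t \<and> finite (D i) \<and> card (D i) \<le> 2 * (t - 1) \<and>
      (\<forall>u\<in>pverts G \<inter> closed_nbhd (P i) (I i) \<inter> closed_nbhd (Q i) (I i).
        \<forall>v\<in>S1 - D i. u \<noteq> v \<longrightarrow> (u, v) \<in> parcs (I i))"
    unfolding good_def .
  \<comment> \<open>Expansion bounds neighbourhoods in \<open>G\<close>; these are contained in the
    ones in \<open>I i\<close>, as \<open>G\<close> is a subgraph of \<open>I i\<close>.\<close>
  define B where "B i = (S2 - closed_nbhd (P i) G) \<union> (S2 - closed_nbhd (Q i) G)" for i
  define T where "T = S2 - (\<Union>i<b. B i)"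
  have missed: "card (S2 - closed_nbhd X G) \<le> card S2 - n" if "X \<subseteq> S1" "card X = t" for X
    using n[OF that] card_Diff_subset_Int[of S2 "closed_nbhd X G"] fin(2)
    by (simp add: Int_commute)
  have "card (B i) \<le> 2 * (card S2 - n)" if "i < b" for i
    using missed[of "P i"] missed[of "Q i"] PQD[OF that]
      card_Un_le[of "S2 - closed_nbhd (P i) G" "S2 - closed_nbhd (Q i) G"]
    unfolding B_def by linarith
  then have "card (\<Union>i<b. B i) \<le> b * (2 * (card S2 - n))"
    by (rule card_UN_lessThan_le)
  moreover have "card S2 \<le> card T + card (\<Union>i<b. B i)"
    using diff_card_le_card_Diff[of "\<Union>i<b. B i" S2] fin(2) unfolding T_def
    by (simp add: B_def)
  ultimately have cT: "card S2 \<le> card T + b * (2 * (card S2 - n))"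
    by linarith
  have "open_nbhd T (graph_complement G) \<inter> S1 \<subseteq> (\<Union>i<b. D i)"
  proof
    fix v assume v: "v \<in> open_nbhd T (graph_complement G) \<inter> S1"
    then obtain u where u: "u \<in> T" "(v, u) \<in> complete_arcs (pverts G)" "(v, u) \<notin> parcs G"
      by (auto simp: open_nbhd_def graph_complement_def)
    have uv: "(u, v) \<in> complete_arcs (pverts G)" "(u, v) \<notin> parcs G"
      using u(2,3) pair_sym_arcs by (auto simp: complete_arcs_def symmetric_def sym_def)
    \<comment> \<open>A non-edge of the intersection is missing from some \<open>I i\<close>, which
      forces \<open>v\<close> into \<open>D i\<close>.\<close>
    then obtain i where i: "i < b" "(u, v) \<notin> parcs (I i)"
      using arcs by blast
    have "u \<in> closed_nbhd (P i) G" "u \<in> closed_nbhd (Q i) G"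
      using u(1) i(1) by (auto simp: T_def B_def)
    moreover have "parcs G \<subseteq> parcs (I i)"
      using arcs i(1) by blast
    ultimately have "u \<in> closed_nbhd (P i) (I i)" "u \<in> closed_nbhd (Q i) (I i)"
      using closed_nbhd_mono by blast+
    then have "v \<in> D i"
      using PQD[OF i(1)] i(2) uv(1) v by (auto simp: complete_arcs_def)
    then show "v \<in> (\<Union>i<b. D i)"
      using i(1) by blast
  qed
  then have "card (open_nbhd T (graph_complement G) \<inter> S1) \<le> card (\<Union>i<b. D i)"
    using PQD by (intro card_mono) auto
  also have "\<dots> \<le> b * (2 * (t - 1))"
    using PQD by (intro card_UN_lessThan_le) blast
  finally show ?thesis
    using cT by (intro exI[of _ T]) (auto simp: T_def)
qed

section \<open>From the count of non-neighbours to the bound on boxicity\<close>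

theorem theorem8:
  fixes G :: "'a pair_pre_digraph" and S1 S2 :: "'a set"
    and b_star t :: nat and \<beta> :: real and t_star :: int and \<alpha>_star :: ereal
  assumes "pair_graph G"
    and "S1 \<subseteq> pverts G" "S2 \<subseteq> pverts G"
    and "S1 \<noteq> {}" "S2 \<noteq> {}"
    and "S1 \<union> S2 = pverts G"
    and "\<not> (\<exists>u\<in>S2. closed_nbhd {u} G \<inter> S1 = S1)"
    and "b_star = boxicity G"
    and "1 \<le> t" "t \<le> card S1"
    and "\<beta> = cross_expansion G t S1 S2"
    and "real_of_int t_star = real (card S2) * (1 - 2 * real b_star * (1 - \<beta>))"
    and "\<alpha>_star = co_expansion G t_star S2 S1"
  shows "real (boxicity G) \<ge>
    1 / (2 * (1 - \<beta> +
      (if \<alpha>_star = \<infinity> then 0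
       else (real t - 1) / (real_of_ereal \<alpha>_star * real (card S2)))))"
proof -
  interpret pair_graph G by fact
  have fin: "finite S1" "finite S2"
    using assms(2,3) finite_subset pair_finite_verts by blast+
  have s2: "card S2 > 0"
    using fin(2) assms(5) by (simp add: card_gt_0_iff)
  define b where "b = boxicity G"
  obtain I where rep: "interval_representation G b I"
    using LeastI_ex[OF interval_representation_exists[OF assms(1)]]
    unfolding b_def boxicity_def by blast
  define n where "n = Min {card (closed_nbhd S G \<inter> S2) | S. S \<subseteq> S1 \<and> card S = t}"
  have n_le: "n \<le> card (closed_nbhd P G \<inter> S2)" if "P \<subseteq> S1" "card P = t" for P
    unfolding n_def using Min_card_subsets_le[OF fin(1) that, of "\<lambda>S. card (closed_nbhd S G \<inter> S2)"] .
  obtain P where "P \<subseteq> S1" "card P = t"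
    using obtain_subset_with_card_n[OF assms(10)] by metis
  then have n: "n \<le> card S2"
    using n_le card_mono[OF fin(2) Int_lower2] order_trans by blast
  have beta: "\<beta> = real n / real (card S2)"
    using assms(11) by (simp add: cross_expansion_def n_def)
  have ts: "real_of_int t_star = real (card S2) - real b * (2 * (real (card S2) - real n))"
  proof -
    have "real n = \<beta> * real (card S2)"
      using s2 by (simp add: beta)
    then show ?thesis
      using assms(12) unfolding assms(8) b_def[symmetric] by (simp add: algebra_simps)
  qed
  have ts': "t_star = int (card S2) - int b * (2 * (int (card S2) - int n))"
  proof -
    have "real_of_int t_star = real_of_int (int (card S2) - int b * (2 * (int (card S2) - int n)))"
      using ts by simp
    then show ?thesis
      by (simp only: of_int_eq_iff)
  qed
  show ?thesis
  proof (cases "t_star \<le> 0")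
    case True
    then have "\<alpha>_star = \<infinity>"
      using assms(13) by (simp add: co_expansion_def)
    moreover have "1 \<le> 2 * real b * (1 - \<beta>)"
      using True assms(12) s2 unfolding assms(8) b_def[symmetric]
      by (metis diff_gt_0_iff_gt linorder_not_less mult_pos_pos of_int_le_0_iff of_nat_0_less_iff)
    moreover have "0 \<le> 1 - \<beta>"
      using n s2 by (simp add: beta)
    ultimately show ?thesis
      \<comment> \<open>Equality \<open>1 - \<beta> = 0\<close> would contradict
        \<open>1 \<le> 2 * real b * (1 - \<beta>)\<close>.\<close>
      unfolding b_def[symmetric] by (cases "1 - \<beta> = 0") (auto simp: field_simps)
  next
    case False
    define m where "m = Min {card (open_nbhd S (graph_complement G) \<inter> S1) | S. S \<subseteq> S2 \<and> card S = nat t_star}"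
    have alpha: "\<alpha>_star = ereal (real m / real_of_int t_star)"
      using False assms(13) by (simp add: co_expansion_def m_def)
    obtain T where T: "T \<subseteq> S2" "card S2 \<le> card T + b * (2 * (card S2 - n))"
      "card (open_nbhd T (graph_complement G) \<inter> S1) \<le> b * (2 * (t - 1))"
      using representation_few_nonneighbours[OF assms(1) rep assms(2,3,9,10) n_le] by blast
    have "t_star \<le> int (card T)"
    proof -
      have "int (card S2) \<le> int (card T + b * (2 * (card S2 - n)))"
        using T(2) by (simp only: of_nat_le_iff)
      then show ?thesis
        using n unfolding ts' by (simp add: of_nat_diff)
    qed
    \<comment> \<open>\<open>m\<close> is a minimum over sets of size exactly \<open>t_star\<close>;
      shrinking \<open>T\<close> can only lose non-neighbours.\<close>
    then obtain T' where T': "T' \<subseteq> T" "card T' = nat t_star"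
      by (metis nat_le_iff obtain_subset_with_card_n)
    have "m \<le> card (open_nbhd T' (graph_complement G) \<inter> S1)"
      unfolding m_def using T' T(1) fin(2)
      by (intro Min_card_subsets_le[where f = "\<lambda>S. card (open_nbhd S (graph_complement G) \<inter> S1)"]) auto
    also have "\<dots> \<le> card (open_nbhd T (graph_complement G) \<inter> S1)"
      using T'(1) fin(1) by (intro card_mono) (auto simp: open_nbhd_def)
    finally have "m \<le> b * (2 * (t - 1))"
      using T(3) by linarith
    then have "real m \<le> real (b * (2 * (t - 1)))"
      by (simp only: of_nat_le_iff)
    then have m_le: "real m \<le> 2 * real b * (real t - 1)"
      using assms(9) by (simp add: of_nat_diff mult_ac)
    have "nat t_star \<le> card S2"
      using \<open>t_star \<le> int (card T)\<close> card_mono[OF fin(2) T(1)] by linarith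
    then obtain U where U: "U \<subseteq> S2" "card U = nat t_star"
      "m = card (open_nbhd U (graph_complement G) \<inter> S1)"
      unfolding m_def
      by (rule Min_card_subsets_attained[OF fin(2), where f = "\<lambda>S. card (open_nbhd S (graph_complement G) \<inter> S1)"])
    obtain u where u: "u \<in> U"
      using U(2) False by fastforce
    \<comment> \<open>No vertex of \<open>S2\<close> dominates \<open>S1\<close>, so the minimiser
      \<open>U\<close> has a non-neighbour there and \<open>m > 0\<close>.\<close>
    then obtain v where v: "v \<in> S1" "v \<notin> closed_nbhd {u} G"
      using assms(7) U(1) by blast
    have "v \<in> open_nbhd U (graph_complement G) \<inter> S1"
      using u v U(1) assms(2,3)
      by (auto simp: open_nbhd_def closed_nbhd_def graph_complement_def complete_arcs_def)
    then have m_pos: "m > 0"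
      using U(3) fin(1) by (auto simp: card_gt_0_iff)
    \<comment> \<open>The bracket in the claim, with \<open>\<alpha>_star\<close> replaced by
      \<open>m / t_star\<close>.\<close>
    define x where "x = 1 - \<beta> + (real t - 1) * real_of_int t_star / (real m * real (card S2))"
    \<comment> \<open>The bound on \<open>m\<close> times \<open>t_star\<close>, with
      \<open>t_star\<close> expanded on the left only.\<close>
    have "real m * real (card S2) * (1 - 2 * real b * (1 - \<beta>)) \<le> 2 * real b * (real t - 1) * real_of_int t_star"
      using mult_right_mono[OF m_le, of "real_of_int t_star"] False assms(12)
      unfolding assms(8) b_def[symmetric] by (simp add: mult_ac)
    then have "1 - 2 * real b * (1 - \<beta>) \<le> 2 * real b * (real t - 1) * real_of_int t_star / (real m * real (card S2))"
      using m_pos s2 by (simp add: pos_le_divide_eq mult_ac)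
    then have "1 \<le> 2 * real b * x"
      unfolding x_def by (simp add: algebra_simps)
    then have "1 / (2 * x) \<le> real b"
      by (cases "x > 0") (auto simp: field_simps intro: order_trans[of _ 0])
    then show ?thesis
      by (simp add: alpha x_def b_def)
  qed
qed

end
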